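(* Let $\mathscr{C}$ be a semi-monoidal category and let $I$ be an object of $\mathscr{C}$. There is a natural bijection between LR unit structures $(\lambda,\rho)$ on $I$ and Saavedra unit structures $\alpha$ on $I$. It sends $(\lambda,\rho)$ to $\alpha := \lambda_I=\rho_I : II\to I$, and its inverse sends $\alpha$ to the pair $(\lambda,\rho)$, where $\lambda_X: IX\to X$ and $\rho_X: XI\to X$ are the unique arrows satisfying $I\lambda_X=\alpha X$ and $\rho_X I = X\alpha$ for every object $X$.
   Context: A semi-monoidal category is a category $\mathscr{C}$ with a strictly associative functor $\mathscr{C}\times\mathscr{C}\to\mathscr{C}$, written as juxtaposition $(X,Y)\mapsto XY$. The identity arrow of an object $X$ is also written $X$, so for an arrow $f$ the expressions $Xf$ and $fX$ denote $\mathrm{id}_X\otimes f$ and $f\otimes\mathrm{id}_X$. An LR unit is an object $I$ with natural isomorphisms $\lambda_X: IX\to X$ and $\rho_X: XI\to X$ satisfying, for all $X,Y$: (1) $\lambda_I=\rho_I$; (2) $\lambda_{XY}=\lambda_X Y$; (3) $\rho_{XY}=X\rho_Y$; (4) $X\lambda_Y=\rho_X Y$. The pair $(\lambda,\rho)$ is then an LR unit structure on $I$. An object $I$ is cancellable if the functors $X\mapsto IX$ and $X\mapsto XI$ are both fully faithful. A Saavedra unit is a pair $(I,\alpha)$ where $I$ is a cancellable object and $\alpha: II\to I$ is an isomorphism (no associativity of $\alpha$ is required). Such an $\alpha$ is a Saavedra unit structure on $I$. *)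

theory Defs
  imports Main "HOL-Library.FuncSet"
begin

section \<open>Categories and functors\<close>

text \<open>
  Categories have a carrier set of objects and a carrier set of arrows. All arrows live in one
  type, with domain and codomain maps, so that the equations between arrows required by strict
  associativity are equations in HOL. The composite written \<open>g\<close> after \<open>f\<close> is \<open>Comp C g f\<close>.
\<close>

record ('o, 'a) cat =
  Obj :: "'o set"
  Arr :: "'a set"
  Dom :: "'a \<Rightarrow> 'o"
  Cod :: "'a \<Rightarrow> 'o"
  Ident :: "'o \<Rightarrow> 'a"
  Comp :: "'a \<Rightarrow> 'a \<Rightarrow> 'a"

definition Hom :: "('o, 'a, 'm) cat_scheme \<Rightarrow> 'o \<Rightarrow> 'o \<Rightarrow> 'a set" where
  "Hom C X Y = {f \<in> Arr C. Dom C f = X \<and> Cod C f = Y}"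

locale category =
  fixes C :: "('o, 'a, 'm) cat_scheme"
  assumes Dom_closed: "f \<in> Arr C \<Longrightarrow> Dom C f \<in> Obj C"
    and Cod_closed: "f \<in> Arr C \<Longrightarrow> Cod C f \<in> Obj C"
    and Ident_closed: "X \<in> Obj C \<Longrightarrow> Ident C X \<in> Hom C X X"
    and Comp_closed: "f \<in> Hom C X Y \<Longrightarrow> g \<in> Hom C Y Z \<Longrightarrow> Comp C g f \<in> Hom C X Z"
    and Comp_Ident_right: "f \<in> Hom C X Y \<Longrightarrow> Comp C f (Ident C X) = f"
    and Comp_Ident_left: "f \<in> Hom C X Y \<Longrightarrow> Comp C (Ident C Y) f = f"
    and Comp_assoc: "f \<in> Hom C W X \<Longrightarrow> g \<in> Hom C X Y \<Longrightarrow> h \<in> Hom C Y Z \<Longrightarrow>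
      Comp C h (Comp C g f) = Comp C (Comp C h g) f"

definition is_iso :: "('o, 'a, 'm) cat_scheme \<Rightarrow> 'o \<Rightarrow> 'o \<Rightarrow> 'a \<Rightarrow> bool" where
  "is_iso C X Y f \<longleftrightarrow> f \<in> Hom C X Y \<and>
     (\<exists>g \<in> Hom C Y X. Comp C g f = Ident C X \<and> Comp C f g = Ident C Y)"

definition prod_cat ::
  "('o, 'a, 'm) cat_scheme \<Rightarrow> ('p, 'b, 'n) cat_scheme \<Rightarrow> ('o \<times> 'p, 'a \<times> 'b) cat" where
  "prod_cat C D =
     \<lparr>Obj = Obj C \<times> Obj D,
      Arr = Arr C \<times> Arr D,
      Dom = map_prod (Dom C) (Dom D),
      Cod = map_prod (Cod C) (Cod D),
      Ident = map_prod (Ident C) (Ident D),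
      Comp = (\<lambda>(g, g') (f, f'). (Comp C g f, Comp D g' f'))\<rparr>"

record ('o, 'a, 'p, 'b) fctr =
  FObj :: "'o \<Rightarrow> 'p"
  FArr :: "'a \<Rightarrow> 'b"

locale is_functor = source: category C + target: category D
  for C :: "('o, 'a, 'm) cat_scheme" and D :: "('p, 'b, 'n) cat_scheme" +
  fixes F :: "('o, 'a, 'p, 'b) fctr"
  assumes FObj_closed: "X \<in> Obj C \<Longrightarrow> FObj F X \<in> Obj D"
    and FArr_closed: "f \<in> Hom C X Y \<Longrightarrow> FArr F f \<in> Hom D (FObj F X) (FObj F Y)"
    and FArr_Ident: "X \<in> Obj C \<Longrightarrow> FArr F (Ident C X) = Ident D (FObj F X)"
    and FArr_Comp: "f \<in> Hom C X Y \<Longrightarrow> g \<in> Hom C Y Z \<Longrightarrow>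
      FArr F (Comp C g f) = Comp D (FArr F g) (FArr F f)"

definition id_fctr :: "('o, 'a, 'o, 'a) fctr" where
  "id_fctr = \<lparr>FObj = (\<lambda>X. X), FArr = (\<lambda>f. f)\<rparr>"

definition fully_faithful ::
  "('o, 'a, 'm) cat_scheme \<Rightarrow> ('p, 'b, 'n) cat_scheme \<Rightarrow> ('o, 'a, 'p, 'b) fctr \<Rightarrow> bool" where
  "fully_faithful C D F \<longleftrightarrow>
     (\<forall>X \<in> Obj C. \<forall>Y \<in> Obj C. bij_betw (FArr F) (Hom C X Y) (Hom D (FObj F X) (FObj F Y)))"

text \<open>
  The components of a transformation form a function on objects that takes the value
  \<^term>\<open>undefined\<close> off the carrier (this is what \<open>\<Pi>\<^sub>E\<close> expresses), so that two transformations
  with the same components are equal.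
\<close>

definition natural_iso ::
  "('o, 'a, 'm) cat_scheme \<Rightarrow> ('p, 'b, 'n) cat_scheme \<Rightarrow>
   ('o, 'a, 'p, 'b) fctr \<Rightarrow> ('o, 'a, 'p, 'b) fctr \<Rightarrow> ('o \<Rightarrow> 'b) \<Rightarrow> bool" where
  "natural_iso C D F G \<tau> \<longleftrightarrow>
     \<tau> \<in> (\<Pi>\<^sub>E X \<in> Obj C. Hom D (FObj F X) (FObj G X)) \<and>
     (\<forall>X \<in> Obj C. \<forall>Y \<in> Obj C. \<forall>f \<in> Hom C X Y.
        Comp D (FArr G f) (\<tau> X) = Comp D (\<tau> Y) (FArr F f)) \<and>
     (\<forall>X \<in> Obj C. is_iso D (FObj F X) (FObj G X) (\<tau> X))"

section \<open>Semi-monoidal categories\<close>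

record ('o, 'a) semi_monoidal = "('o, 'a) cat" +
  Tensor :: "('o \<times> 'o, 'a \<times> 'a, 'o, 'a) fctr"

definition tens_obj :: "('o, 'a, 'm) semi_monoidal_scheme \<Rightarrow> 'o \<Rightarrow> 'o \<Rightarrow> 'o"
    (infixr "\<odot>\<index>" 70) where
  "X \<odot>\<^bsub>C\<^esub> Y = FObj (Tensor C) (X, Y)"

definition tens_arr :: "('o, 'a, 'm) semi_monoidal_scheme \<Rightarrow> 'a \<Rightarrow> 'a \<Rightarrow> 'a"
    (infixr "\<otimes>\<index>" 70) where
  "f \<otimes>\<^bsub>C\<^esub> g = FArr (Tensor C) (f, g)"

locale semi_monoidal_category = category C + tensor: is_functor "prod_cat C C" C "Tensor C"
  for C :: "('o, 'a, 'm) semi_monoidal_scheme" (structure) +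
  assumes tens_obj_assoc: "X \<in> Obj C \<Longrightarrow> Y \<in> Obj C \<Longrightarrow> Z \<in> Obj C \<Longrightarrow>
      (X \<odot> Y) \<odot> Z = X \<odot> (Y \<odot> Z)"
    and tens_arr_assoc: "f \<in> Arr C \<Longrightarrow> g \<in> Arr C \<Longrightarrow> h \<in> Arr C \<Longrightarrow>
      (f \<otimes> g) \<otimes> h = f \<otimes> (g \<otimes> h)"

definition left_whisker :: "('o, 'a, 'm) semi_monoidal_scheme \<Rightarrow> 'o \<Rightarrow> 'a \<Rightarrow> 'a"
    (infixr "\<rhd>\<index>" 70) where
  "X \<rhd>\<^bsub>C\<^esub> f = Ident C X \<otimes>\<^bsub>C\<^esub> f"

definition right_whisker :: "('o, 'a, 'm) semi_monoidal_scheme \<Rightarrow> 'a \<Rightarrow> 'o \<Rightarrow> 'a"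
    (infixl "\<lhd>\<index>" 70) where
  "f \<lhd>\<^bsub>C\<^esub> X = f \<otimes>\<^bsub>C\<^esub> Ident C X"

definition left_tens :: "('o, 'a, 'm) semi_monoidal_scheme \<Rightarrow> 'o \<Rightarrow> ('o, 'a, 'o, 'a) fctr" where
  "left_tens C I = \<lparr>FObj = (\<lambda>X. I \<odot>\<^bsub>C\<^esub> X), FArr = (\<lambda>f. I \<rhd>\<^bsub>C\<^esub> f)\<rparr>"

definition right_tens :: "('o, 'a, 'm) semi_monoidal_scheme \<Rightarrow> 'o \<Rightarrow> ('o, 'a, 'o, 'a) fctr" where
  "right_tens C I = \<lparr>FObj = (\<lambda>X. X \<odot>\<^bsub>C\<^esub> I), FArr = (\<lambda>f. f \<lhd>\<^bsub>C\<^esub> I)\<rparr>"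

section \<open>Units\<close>

definition LR_unit_structures ::
  "('o, 'a, 'm) semi_monoidal_scheme \<Rightarrow> 'o \<Rightarrow> (('o \<Rightarrow> 'a) \<times> ('o \<Rightarrow> 'a)) set" where
  "LR_unit_structures C I = {(l, r).
     natural_iso C C (left_tens C I) id_fctr l \<and>
     natural_iso C C (right_tens C I) id_fctr r \<and>
     l I = r I \<and>
     (\<forall>X \<in> Obj C. \<forall>Y \<in> Obj C. l (X \<odot>\<^bsub>C\<^esub> Y) = l X \<lhd>\<^bsub>C\<^esub> Y) \<and>
     (\<forall>X \<in> Obj C. \<forall>Y \<in> Obj C. r (X \<odot>\<^bsub>C\<^esub> Y) = X \<rhd>\<^bsub>C\<^esub> r Y) \<and>
     (\<forall>X \<in> Obj C. \<forall>Y \<in> Obj C. X \<rhd>\<^bsub>C\<^esub> l Y = r X \<lhd>\<^bsub>C\<^esub> Y)}"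

definition cancellable :: "('o, 'a, 'm) semi_monoidal_scheme \<Rightarrow> 'o \<Rightarrow> bool" where
  "cancellable C I \<longleftrightarrow>
     fully_faithful C C (left_tens C I) \<and> fully_faithful C C (right_tens C I)"

text \<open>
  Cancellability is a property of \<open>I\<close>, so the set below is empty unless \<open>I\<close> is cancellable.
\<close>

definition Saavedra_unit_structures :: "('o, 'a, 'm) semi_monoidal_scheme \<Rightarrow> 'o \<Rightarrow> 'a set" where
  "Saavedra_unit_structures C I = {\<alpha>. cancellable C I \<and> is_iso C (I \<odot>\<^bsub>C\<^esub> I) I \<alpha>}"

end

theory Submission
  imports Defs
begin

text \<open>
  For an LR unit, condition (4) at \<open>X = I\<close> reads \<open>I \<lambda>\<^sub>Y = \<rho>\<^sub>I Y = \<alpha> Y\<close>, and dually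
  \<open>\<rho>\<^sub>X I = X \<alpha>\<close>; tensoring with \<open>I\<close> is naturally isomorphic to the identity functor, so \<open>I\<close> is
  cancellable and \<open>\<alpha>\<close> determines \<open>\<lambda>\<close> and \<open>\<rho>\<close>. Conversely, full faithfulness lifts the natural
  isomorphisms \<open>\<alpha> X\<close> and \<open>X \<alpha>\<close> to \<open>\<lambda>\<close> and \<open>\<rho>\<close>. For condition (4), the arrows
  \<open>X I \<lambda>\<^sub>Y = X \<alpha> Y = \<rho>\<^sub>X I Y\<close> coincide, and the two ways to compute \<open>\<rho>\<^sub>X \<otimes> \<lambda>\<^sub>Y\<close> give
  \<open>(\<rho>\<^sub>X Y)(X I \<lambda>\<^sub>Y) = (X \<lambda>\<^sub>Y)(\<rho>\<^sub>X I Y)\<close>, so this isomorphism cancels. Then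
  \<open>\<alpha> I = I \<lambda>\<^sub>I = \<rho>\<^sub>I I = I \<alpha>\<close>, whence \<open>\<lambda>\<^sub>I = \<alpha> = \<rho>\<^sub>I\<close>.
\<close>

section \<open>Isomorphisms, functors and natural isomorphisms\<close>

lemma HomD: "f \<in> Hom C X Y \<Longrightarrow> f \<in> Arr C \<and> Dom C f = X \<and> Cod C f = Y"
  by (simp add: Hom_def)

lemma is_isoE:
  assumes "is_iso C X Y f"
  obtains g where "f \<in> Hom C X Y" "g \<in> Hom C Y X"
    "Comp C g f = Ident C X" "Comp C f g = Ident C Y"
  using assms by (auto simp: is_iso_def)

context category
begin

lemma Hom_objs: "f \<in> Hom C X Y \<Longrightarrow> X \<in> Obj C \<and> Y \<in> Obj C"
  using Dom_closed Cod_closed by (auto simp: Hom_def)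

lemma is_iso_cancel_left:
  assumes "is_iso C Y Z h" "f \<in> Hom C X Y" "g \<in> Hom C X Y" "Comp C h f = Comp C h g"
  shows "f = g"
  using assms(1)
proof (rule is_isoE)
  fix k assume k: "h \<in> Hom C Y Z" "k \<in> Hom C Z Y" "Comp C k h = Ident C Y"
  show ?thesis
    using Comp_assoc[OF assms(2) k(1,2)] Comp_assoc[OF assms(3) k(1,2)]
    by (metis k(3) assms(4) Comp_Ident_left[OF assms(2)] Comp_Ident_left[OF assms(3)])
qed

lemma is_iso_cancel_right:
  assumes "is_iso C X Y h" "f \<in> Hom C Y Z" "g \<in> Hom C Y Z" "Comp C f h = Comp C g h"
  shows "f = g"
  using assms(1)
proof (rule is_isoE)
  fix k assume k: "h \<in> Hom C X Y" "k \<in> Hom C Y X" "Comp C h k = Ident C Y"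
  show ?thesis
    using Comp_assoc[OF k(2,1) assms(2)] Comp_assoc[OF k(2,1) assms(3)]
    by (metis k(3) assms(4) Comp_Ident_right[OF assms(2)] Comp_Ident_right[OF assms(3)])
qed

end

lemma (in is_functor) FArr_is_iso:
  assumes "is_iso C X Y f" shows "is_iso D (FObj F X) (FObj F Y) (FArr F f)"
  using assms
proof (rule is_isoE)
  fix g assume g: "f \<in> Hom C X Y" "g \<in> Hom C Y X"
    "Comp C g f = Ident C X" "Comp C f g = Ident C Y"
  have "X \<in> Obj C" "Y \<in> Obj C" using source.Hom_objs[OF g(1)] by auto
  then show ?thesis
    using FArr_closed[OF g(1)] FArr_closed[OF g(2)] FArr_Comp[OF g(1,2)] FArr_Comp[OF g(2,1)]
    by (auto simp: is_iso_def g FArr_Ident)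
qed

text \<open>Serves to express that a family such as \<alpha> X is a transformation between
  composites \<open>F G\<close> and \<open>F H\<close>, the form from which a fully faithful
  \<open>F\<close> can be stripped off.\<close>

definition comp_fctr ::
  "('p, 'b, 'q, 'c) fctr \<Rightarrow> ('o, 'a, 'p, 'b) fctr \<Rightarrow> ('o, 'a, 'q, 'c) fctr" where
  "comp_fctr F G = \<lparr>FObj = FObj F \<circ> FObj G, FArr = FArr F \<circ> FArr G\<rparr>"

lemma comp_fctr_simps [simp]:
  "FObj (comp_fctr F G) X = FObj F (FObj G X)" "FArr (comp_fctr F G) f = FArr F (FArr G f)"
  by (simp_all add: comp_fctr_def)

lemma id_fctr_simps [simp]: "FObj id_fctr X = X" "FArr id_fctr f = f"
  by (simp_all add: id_fctr_def)

lemma (in category) is_functor_id: "is_functor C C id_fctr"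
  by unfold_locales (auto simp: Dom_closed Cod_closed)

lemma natural_isoD:
  assumes "natural_iso C D F G \<tau>"
  shows "\<tau> \<in> extensional (Obj C)"
    and "X \<in> Obj C \<Longrightarrow> \<tau> X \<in> Hom D (FObj F X) (FObj G X)"
    and "X \<in> Obj C \<Longrightarrow> is_iso D (FObj F X) (FObj G X) (\<tau> X)"
    and "X \<in> Obj C \<Longrightarrow> Y \<in> Obj C \<Longrightarrow> f \<in> Hom C X Y \<Longrightarrow>
      Comp D (FArr G f) (\<tau> X) = Comp D (\<tau> Y) (FArr F f)"
  using assms by (auto simp: natural_iso_def PiE_def)

lemma fully_faithful_bij:
  assumes "fully_faithful C D F" "X \<in> Obj C" "Y \<in> Obj C"
  shows "bij_betw (FArr F) (Hom C X Y) (Hom D (FObj F X) (FObj F Y))"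
  using assms by (simp add: fully_faithful_def)

lemma fully_faithful_eqD:
  assumes "fully_faithful C D F" "X \<in> Obj C" "Y \<in> Obj C"
    "f \<in> Hom C X Y" "g \<in> Hom C X Y" "FArr F f = FArr F g"
  shows "f = g"
  using fully_faithful_bij[OF assms(1-3)] assms(4-6) by (auto simp: bij_betw_def dest: inj_onD)

lemma fully_faithful_ex1:
  assumes "fully_faithful C D F" "X \<in> Obj C" "Y \<in> Obj C" "h \<in> Hom D (FObj F X) (FObj F Y)"
  shows "\<exists>!f. f \<in> Hom C X Y \<and> FArr F f = h"
proof -
  obtain f where "f \<in> Hom C X Y" "FArr F f = h"
    using fully_faithful_bij[OF assms(1-3)] assms(4) by (metis bij_betw_imp_surj_on imageE)
  then show ?thesis using fully_faithful_eqD[OF assms(1-3)] by metis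
qed

context is_functor
begin

text \<open>Fullness supplies a preimage of the inverse, and faithfulness reflects both inverse
  laws.\<close>

lemma fully_faithful_reflects_iso:
  assumes ff: "fully_faithful C D F"
    and f: "f \<in> Hom C X Y" and iso: "is_iso D (FObj F X) (FObj F Y) (FArr F f)"
  shows "is_iso C X Y f"
  using iso
proof (rule is_isoE)
  fix k assume k: "k \<in> Hom D (FObj F Y) (FObj F X)"
    "Comp D k (FArr F f) = Ident D (FObj F X)" "Comp D (FArr F f) k = Ident D (FObj F Y)"
  have X: "X \<in> Obj C" and Y: "Y \<in> Obj C" using source.Hom_objs[OF f] by auto
  obtain g where g: "g \<in> Hom C Y X" "FArr F g = k"
    using fully_faithful_ex1[OF ff Y X k(1)] by auto
  have "Comp C g f = Ident C X"
    by (rule fully_faithful_eqD[OF ff X X source.Comp_closed[OF f g(1)] source.Ident_closed[OF X]])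
      (simp add: FArr_Comp[OF f g(1)] FArr_Ident[OF X] g k)
  moreover have "Comp C f g = Ident C Y"
    by (rule fully_faithful_eqD[OF ff Y Y source.Comp_closed[OF g(1) f] source.Ident_closed[OF Y]])
      (simp add: FArr_Comp[OF g(1) f] FArr_Ident[OF Y] g k)
  ultimately show ?thesis using f g(1) by (auto simp: is_iso_def)
qed

text \<open>\<open>F\<close> sends the naturality squares of \<open>\<tau>\<close> to those of
  \<open>\<beta>\<close>, so faithfulness reflects them; invertibility is reflected componentwise.
  It is applied with \<open>F\<close> and \<open>G\<close> the same tensoring functor and
  \<open>H\<close> the identity.\<close>

lemma fully_faithful_reflects_natural_iso:
  assumes ff: "fully_faithful C D F"
    and G: "is_functor B C G" and H: "is_functor B C H"
    and nat: "natural_iso B D (comp_fctr F G) (comp_fctr F H) \<beta>"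
    and \<tau>: "\<tau> \<in> (\<Pi>\<^sub>E X \<in> Obj B. Hom C (FObj G X) (FObj H X))"
    and lift: "\<And>X. X \<in> Obj B \<Longrightarrow> FArr F (\<tau> X) = \<beta> X"
  shows "natural_iso B C G H \<tau>"
proof -
  interpret G: is_functor B C G by fact
  interpret H: is_functor B C H by fact
  have \<tau>_Hom: "\<tau> X \<in> Hom C (FObj G X) (FObj H X)" if "X \<in> Obj B" for X
    using \<tau> that by blast
  have "Comp C (FArr H f) (\<tau> X) = Comp C (\<tau> Y) (FArr G f)"
    if X: "X \<in> Obj B" and Y: "Y \<in> Obj B" and f: "f \<in> Hom B X Y" for X Y f
  proof (rule fully_faithful_eqD[OF ff G.FObj_closed[OF X] H.FObj_closed[OF Y]])
    show "FArr F (Comp C (FArr H f) (\<tau> X)) = FArr F (Comp C (\<tau> Y) (FArr G f))"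
      using natural_isoD(4)[OF nat X Y f]
      by (simp add: FArr_Comp[OF \<tau>_Hom[OF X] H.FArr_closed[OF f]]
          FArr_Comp[OF G.FArr_closed[OF f] \<tau>_Hom[OF Y]] lift X Y)
  qed (use source.Comp_closed \<tau>_Hom X Y G.FArr_closed H.FArr_closed f in blast)+
  moreover have "is_iso C (FObj G X) (FObj H X) (\<tau> X)" if X: "X \<in> Obj B" for X
    using fully_faithful_reflects_iso[OF ff \<tau>_Hom[OF X]] natural_isoD(3)[OF nat X] lift[OF X]
    by simp
  ultimately show ?thesis using \<tau> by (simp add: natural_iso_def)
qed

end

text \<open>Naturality makes \<open>FArr F f\<close> the conjugate of \<open>f\<close> by the
  components of \<open>\<tau>\<close>, and conjugation by isomorphisms is bijective on
  hom-sets.\<close>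

lemma fully_faithful_if_natural_iso_id:
  assumes F: "is_functor C C F" and nat: "natural_iso C C F id_fctr \<tau>"
  shows "fully_faithful C C F"
  unfolding fully_faithful_def
proof (intro ballI)
  interpret F: is_functor C C F by fact
  fix X Y assume X: "X \<in> Obj C" and Y: "Y \<in> Obj C"
  note \<tau> = natural_isoD[OF nat, simplified]
  show "bij_betw (FArr F) (Hom C X Y) (Hom C (FObj F X) (FObj F Y))"
  proof (rule bij_betw_imageI)
    show "inj_on (FArr F) (Hom C X Y)"
    proof (rule inj_onI)
      fix f g assume f: "f \<in> Hom C X Y" and g: "g \<in> Hom C X Y" and "FArr F f = FArr F g"
      then have "Comp C f (\<tau> X) = Comp C g (\<tau> X)" using \<tau>(4)[OF X Y] by metis
      then show "f = g" using F.source.is_iso_cancel_right[OF \<tau>(3)[OF X] f g] by simp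
    qed
    have "h \<in> FArr F ` Hom C X Y" if h: "h \<in> Hom C (FObj F X) (FObj F Y)" for h
      using \<tau>(3)[OF X]
    proof (rule is_isoE)
      fix k assume k: "k \<in> Hom C X (FObj F X)" "Comp C k (\<tau> X) = Ident C (FObj F X)"
      \<comment> \<open>The only possible preimage of \<open>h\<close>: naturality requires that
        \<open>f\<close> after \<open>\<tau> X\<close> be \<open>\<tau> Y\<close> after
        \<open>h\<close>, and \<open>k\<close> is the inverse of \<open>\<tau> X\<close>.\<close>
      define f where "f = Comp C (Comp C (\<tau> Y) h) k"
      have \<tau>h: "Comp C (\<tau> Y) h \<in> Hom C (FObj F X) Y"
        using F.source.Comp_closed[OF h \<tau>(2)[OF Y]] .
      then have f: "f \<in> Hom C X Y" unfolding f_def using F.source.Comp_closed k(1) by blast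
      have "Comp C (\<tau> Y) (FArr F f) = Comp C f (\<tau> X)" using \<tau>(4)[OF X Y f] by simp
      also have "\<dots> = Comp C (\<tau> Y) h"
        unfolding f_def F.source.Comp_assoc[OF \<tau>(2)[OF X] k(1) \<tau>h, symmetric] k(2)
        by (rule F.source.Comp_Ident_right[OF \<tau>h])
      finally have "FArr F f = h"
        using F.source.is_iso_cancel_left[OF \<tau>(3)[OF Y] F.FArr_closed[OF f] h] by simp
      then show ?thesis using f by blast
    qed
    then show "FArr F ` Hom C X Y = Hom C (FObj F X) (FObj F Y)"
      using F.FArr_closed by blast
  qed
qed

section \<open>Tensoring and whiskering in a semi-monoidal category\<close>

lemma tens_fctr_simps [simp]:
  "FObj (left_tens C I) X = I \<odot>\<^bsub>C\<^esub> X" "FArr (left_tens C I) f = I \<rhd>\<^bsub>C\<^esub> f"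
  "FObj (right_tens C I) X = X \<odot>\<^bsub>C\<^esub> I" "FArr (right_tens C I) f = f \<lhd>\<^bsub>C\<^esub> I"
  by (simp_all add: left_tens_def right_tens_def)

context semi_monoidal_category
begin

lemma tens_obj_closed: "X \<in> Obj C \<Longrightarrow> Y \<in> Obj C \<Longrightarrow> X \<odot> Y \<in> Obj C"
  using tensor.FObj_closed[of "(X, Y)"] by (simp add: prod_cat_def tens_obj_def)

lemma Hom_prod_cat: "Hom (prod_cat C C) (X, X') (Y, Y') = Hom C X Y \<times> Hom C X' Y'"
  by (auto simp: Hom_def prod_cat_def)

lemma tens_arr_closed:
  "f \<in> Hom C X Y \<Longrightarrow> g \<in> Hom C X' Y' \<Longrightarrow> f \<otimes> g \<in> Hom C (X \<odot> X') (Y \<odot> Y')"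
  using tensor.FArr_closed[of "(f, g)" "(X, X')" "(Y, Y')"]
  by (simp add: Hom_prod_cat tens_arr_def tens_obj_def)

lemma tens_Ident: "X \<in> Obj C \<Longrightarrow> Y \<in> Obj C \<Longrightarrow> Ident C X \<otimes> Ident C Y = Ident C (X \<odot> Y)"
  using tensor.FArr_Ident[of "(X, Y)"] by (simp add: prod_cat_def tens_arr_def tens_obj_def)

lemma interchange:
  assumes "f \<in> Hom C X Y" "g \<in> Hom C Y Z" "f' \<in> Hom C X' Y'" "g' \<in> Hom C Y' Z'"
  shows "Comp C g f \<otimes> Comp C g' f' = Comp C (g \<otimes> g') (f \<otimes> f')"
  using tensor.FArr_Comp[of "(f, f')" "(X, X')" "(Y, Y')" "(g, g')" "(Z, Z')"] assms
  by (simp add: Hom_prod_cat tens_arr_def) (simp add: prod_cat_def)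

lemma left_whisker_closed:
  "X \<in> Obj C \<Longrightarrow> f \<in> Hom C Y Z \<Longrightarrow> X \<rhd> f \<in> Hom C (X \<odot> Y) (X \<odot> Z)"
  unfolding left_whisker_def by (intro tens_arr_closed Ident_closed)

lemma right_whisker_closed:
  "X \<in> Obj C \<Longrightarrow> f \<in> Hom C Y Z \<Longrightarrow> f \<lhd> X \<in> Hom C (Y \<odot> X) (Z \<odot> X)"
  unfolding right_whisker_def by (intro tens_arr_closed Ident_closed)

text \<open>Interchange with an identity in each factor. It yields both the naturality of whiskered
  \<alpha> and the cancellation argument for condition (4).\<close>

lemma whisker_exchange:
  assumes "f \<in> Hom C X X'" "g \<in> Hom C Y Y'"
  shows "Comp C (f \<lhd> Y') (X \<rhd> g) = f \<otimes> g" "Comp C (X' \<rhd> g) (f \<lhd> Y) = f \<otimes> g"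
  using Hom_objs[OF assms(1)] Hom_objs[OF assms(2)]
    interchange[OF Ident_closed assms(1,2) Ident_closed]
    interchange[OF assms(1) Ident_closed Ident_closed assms(2)]
  by (auto simp: left_whisker_def right_whisker_def
      Comp_Ident_left[OF assms(1)] Comp_Ident_left[OF assms(2)]
      Comp_Ident_right[OF assms(1)] Comp_Ident_right[OF assms(2)])

lemma is_functor_left_tens:
  assumes I: "I \<in> Obj C" shows "is_functor C C (left_tens C I)"
proof
  fix f X Y g Z assume f: "f \<in> Hom C X Y" and g: "g \<in> Hom C Y Z"
  show "FArr (left_tens C I) (Comp C g f)
      = Comp C (FArr (left_tens C I) g) (FArr (left_tens C I) f)"
    using interchange[OF Ident_closed[OF I] Ident_closed[OF I] f g]
    by (simp add: left_whisker_def Comp_Ident_left[OF Ident_closed[OF I]])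
qed (simp_all add: I tens_obj_closed left_whisker_closed, simp add: I tens_Ident left_whisker_def)

lemma is_functor_right_tens:
  assumes I: "I \<in> Obj C" shows "is_functor C C (right_tens C I)"
proof
  fix f X Y g Z assume f: "f \<in> Hom C X Y" and g: "g \<in> Hom C Y Z"
  show "FArr (right_tens C I) (Comp C g f)
      = Comp C (FArr (right_tens C I) g) (FArr (right_tens C I) f)"
    using interchange[OF f g Ident_closed[OF I] Ident_closed[OF I]]
    by (simp add: right_whisker_def Comp_Ident_left[OF Ident_closed[OF I]])
qed (simp_all add: I tens_obj_closed right_whisker_closed, simp add: I tens_Ident right_whisker_def)

text \<open>Strict associativity with two of the three arrows identities, splitting the identity of
  a product object by \<open>tens_Ident\<close> where one occurs.\<close>

lemma whisker_tens_obj: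
  assumes "X \<in> Obj C" "Y \<in> Obj C" "f \<in> Hom C Z W"
  shows "X \<rhd> (Y \<rhd> f) = (X \<odot> Y) \<rhd> f" "(f \<lhd> X) \<lhd> Y = f \<lhd> (X \<odot> Y)"
    "(X \<rhd> f) \<lhd> Y = X \<rhd> (f \<lhd> Y)"
  using assms HomD[OF assms(3)] HomD[OF Ident_closed]
  by (simp_all add: left_whisker_def right_whisker_def tens_Ident[symmetric] tens_arr_assoc)

text \<open>The naturality square is the exchange law for \<alpha> and f. Writing the target as a
  composite with \<open>id_fctr\<close> makes left tensoring with I the common outer functor, so
  that full faithfulness can remove it.\<close>

lemma natural_iso_right_whisker:
  assumes I: "I \<in> Obj C" and \<alpha>: "is_iso C (I \<odot> I) I \<alpha>"
  shows "natural_iso C C (comp_fctr (left_tens C I) (left_tens C I))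
    (comp_fctr (left_tens C I) id_fctr) (\<lambda>X \<in> Obj C. \<alpha> \<lhd> X)"
proof -
  have \<alpha>_Hom: "\<alpha> \<in> Hom C (I \<odot> I) I" using \<alpha> by (simp add: is_iso_def)
  \<comment> \<open>This is the image of \<alpha> under right tensoring with X; strict associativity
    turns its domain (II)X into I(IX), the value of the composite functor.\<close>
  have iso: "is_iso C (I \<odot> I \<odot> X) (I \<odot> X) (\<alpha> \<lhd> X)" if X: "X \<in> Obj C" for X
    using is_functor.FArr_is_iso[OF is_functor_right_tens[OF X] \<alpha>]
    by (simp add: tens_obj_assoc I X)
  moreover have "Comp C (I \<rhd> f) (\<alpha> \<lhd> X) = Comp C (\<alpha> \<lhd> Y) (I \<rhd> (I \<rhd> f))"
    if "f \<in> Hom C X Y" for f X Y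
    using whisker_exchange[OF \<alpha>_Hom that] by (simp add: whisker_tens_obj(1)[OF I I that])
  ultimately show ?thesis by (auto simp: natural_iso_def is_iso_def)
qed

lemma natural_iso_left_whisker:
  assumes I: "I \<in> Obj C" and \<alpha>: "is_iso C (I \<odot> I) I \<alpha>"
  shows "natural_iso C C (comp_fctr (right_tens C I) (right_tens C I))
    (comp_fctr (right_tens C I) id_fctr) (\<lambda>X \<in> Obj C. X \<rhd> \<alpha>)"
proof -
  have \<alpha>_Hom: "\<alpha> \<in> Hom C (I \<odot> I) I" using \<alpha> by (simp add: is_iso_def)
  have iso: "is_iso C ((X \<odot> I) \<odot> I) (X \<odot> I) (X \<rhd> \<alpha>)" if X: "X \<in> Obj C" for X
    using is_functor.FArr_is_iso[OF is_functor_left_tens[OF X] \<alpha>]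
    by (simp add: tens_obj_assoc I X)
  moreover have "Comp C (f \<lhd> I) (X \<rhd> \<alpha>) = Comp C (Y \<rhd> \<alpha>) (f \<lhd> I \<lhd> I)"
    if "f \<in> Hom C X Y" for f X Y
    using whisker_exchange[OF that \<alpha>_Hom] by (simp add: whisker_tens_obj(2)[OF I I that])
  ultimately show ?thesis by (auto simp: natural_iso_def is_iso_def)
qed

section \<open>Passage between LR units and Saavedra units\<close>

lemma LR_unit_lifts:
  assumes I: "I \<in> Obj C" and LR: "(l, r) \<in> LR_unit_structures C I"
  shows "l I \<in> Saavedra_unit_structures C I"
    and "l \<in> (\<Pi>\<^sub>E X \<in> Obj C. Hom C (I \<odot> X) X)" "r \<in> (\<Pi>\<^sub>E X \<in> Obj C. Hom C (X \<odot> I) X)"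
    and "X \<in> Obj C \<Longrightarrow> I \<rhd> l X = l I \<lhd> X" "X \<in> Obj C \<Longrightarrow> r X \<lhd> I = X \<rhd> l I"
proof -
  have l: "natural_iso C C (left_tens C I) id_fctr l"
    and r: "natural_iso C C (right_tens C I) id_fctr r"
    and eq: "l I = r I"
    and middle: "\<And>X Y. X \<in> Obj C \<Longrightarrow> Y \<in> Obj C \<Longrightarrow> X \<rhd> l Y = r X \<lhd> Y"
    using LR by (auto simp: LR_unit_structures_def)
  \<comment> \<open>Both tensoring functors are isomorphic to the identity, through \<open>l\<close>
    and \<open>r\<close>, hence fully faithful; \<open>l I\<close> is invertible as a component of
    \<open>l\<close>.\<close>
  show "l I \<in> Saavedra_unit_structures C I"
    using fully_faithful_if_natural_iso_id[OF is_functor_left_tens[OF I] l]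
      fully_faithful_if_natural_iso_id[OF is_functor_right_tens[OF I] r]
      natural_isoD(3)[OF l I]
    by (simp add: Saavedra_unit_structures_def cancellable_def)
  show "l \<in> (\<Pi>\<^sub>E X \<in> Obj C. Hom C (I \<odot> X) X)" "r \<in> (\<Pi>\<^sub>E X \<in> Obj C. Hom C (X \<odot> I) X)"
    using l r by (auto simp: natural_iso_def)
  \<comment> \<open>Condition (4) with I as first object and then as second; \<open>eq\<close>
    replaces \<open>r I\<close> by \<open>l I\<close> in the former.\<close>
  show "I \<rhd> l X = l I \<lhd> X" "r X \<lhd> I = X \<rhd> l I" if "X \<in> Obj C"
    using middle[OF I that] middle[OF that I] eq by auto
qed

text \<open>The arrow \<alpha> X runs from I(IX) to IX, so it lies in the hom-set onto which left
  tensoring with I maps the arrows from IX to X bijectively; dually for X \<alpha>.\<close>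

lemma Saavedra_ex1:
  assumes I: "I \<in> Obj C" and \<alpha>: "\<alpha> \<in> Saavedra_unit_structures C I" and X: "X \<in> Obj C"
  shows "\<exists>!f. f \<in> Hom C (I \<odot> X) X \<and> I \<rhd> f = \<alpha> \<lhd> X"
    and "\<exists>!f. f \<in> Hom C (X \<odot> I) X \<and> f \<lhd> I = X \<rhd> \<alpha>"
proof -
  have ff: "fully_faithful C C (left_tens C I)" "fully_faithful C C (right_tens C I)"
    and iso: "is_iso C (I \<odot> I) I \<alpha>"
    using \<alpha> by (auto simp: Saavedra_unit_structures_def cancellable_def)
  show "\<exists>!f. f \<in> Hom C (I \<odot> X) X \<and> I \<rhd> f = \<alpha> \<lhd> X"
    using fully_faithful_ex1[OF ff(1) tens_obj_closed[OF I X] X]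
      natural_isoD(2)[OF natural_iso_right_whisker[OF I iso] X] X by simp
  show "\<exists>!f. f \<in> Hom C (X \<odot> I) X \<and> f \<lhd> I = X \<rhd> \<alpha>"
    using fully_faithful_ex1[OF ff(2) tens_obj_closed[OF X I] X]
      natural_isoD(2)[OF natural_iso_left_whisker[OF I iso] X] X by simp
qed

text \<open>Natural isomorphy is lifted first, since proving (4) cancels a whiskering of the
  isomorphism \<open>l Y\<close>. Condition (4) then gives (1), while (2) and (3) follow from
  faithfulness and the lifting equations.\<close>

lemma LR_unit_if_lifts:
  assumes I: "I \<in> Obj C" and \<alpha>: "\<alpha> \<in> Saavedra_unit_structures C I"
    and l: "l \<in> (\<Pi>\<^sub>E X \<in> Obj C. Hom C (I \<odot> X) X)"
    and r: "r \<in> (\<Pi>\<^sub>E X \<in> Obj C. Hom C (X \<odot> I) X)"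
    and l_lift: "\<And>X. X \<in> Obj C \<Longrightarrow> I \<rhd> l X = \<alpha> \<lhd> X"
    and r_lift: "\<And>X. X \<in> Obj C \<Longrightarrow> r X \<lhd> I = X \<rhd> \<alpha>"
  shows "(l, r) \<in> LR_unit_structures C I" and "l I = \<alpha>"
proof -
  have ffl: "fully_faithful C C (left_tens C I)" and ffr: "fully_faithful C C (right_tens C I)"
    and iso: "is_iso C (I \<odot> I) I \<alpha>"
    using \<alpha> by (auto simp: Saavedra_unit_structures_def cancellable_def)
  have \<alpha>_Hom: "\<alpha> \<in> Hom C (I \<odot> I) I" using iso by (simp add: is_iso_def)
  have II: "I \<odot> I \<in> Obj C" using I by (rule tens_obj_closed[OF _ I])
  have l_Hom: "l X \<in> Hom C (I \<odot> X) X" and r_Hom: "r X \<in> Hom C (X \<odot> I) X" if "X \<in> Obj C" for X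
    using l r that by auto
  have nat_l: "natural_iso C C (left_tens C I) id_fctr l"
    by (rule is_functor.fully_faithful_reflects_natural_iso[OF is_functor_left_tens[OF I] ffl
          is_functor_left_tens[OF I] is_functor_id natural_iso_right_whisker[OF I iso]])
      (use l l_lift in simp_all)
  have nat_r: "natural_iso C C (right_tens C I) id_fctr r"
    by (rule is_functor.fully_faithful_reflects_natural_iso[OF is_functor_right_tens[OF I] ffr
          is_functor_right_tens[OF I] is_functor_id natural_iso_left_whisker[OF I iso]])
      (use r r_lift in simp_all)
  have middle: "X \<rhd> l Y = r X \<lhd> Y" if X: "X \<in> Obj C" and Y: "Y \<in> Obj C" for X Y
  proof -
    have "(X \<odot> I) \<rhd> l Y = X \<rhd> (I \<rhd> l Y)"
      by (rule whisker_tens_obj(1)[OF X I l_Hom[OF Y], symmetric])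
    also have "\<dots> = (X \<rhd> \<alpha>) \<lhd> Y"
      by (simp add: l_lift[OF Y] whisker_tens_obj(3)[OF X Y \<alpha>_Hom])
    also have "\<dots> = r X \<lhd> (I \<odot> Y)"
      by (simp add: r_lift[OF X, symmetric] whisker_tens_obj(2)[OF I Y r_Hom[OF X]])
    \<comment> \<open>Exchanging \<open>r X\<close> with \<open>l Y\<close> equates two composites;
      by the chain just proved, both start with the same arrow.\<close>
    finally have "Comp C (X \<rhd> l Y) ((X \<odot> I) \<rhd> l Y) = Comp C (r X \<lhd> Y) ((X \<odot> I) \<rhd> l Y)"
      using whisker_exchange[OF r_Hom[OF X] l_Hom[OF Y]] by simp
    moreover have "is_iso C ((X \<odot> I) \<odot> I \<odot> Y) ((X \<odot> I) \<odot> Y) ((X \<odot> I) \<rhd> l Y)"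
      using is_functor.FArr_is_iso[OF is_functor_left_tens[OF tens_obj_closed[OF X I]]
          natural_isoD(3)[OF nat_l Y]] by simp
    ultimately show ?thesis
      using is_iso_cancel_right left_whisker_closed[OF X l_Hom[OF Y]]
        right_whisker_closed[OF Y r_Hom[OF X]]
      by (metis tens_obj_assoc[OF X I Y])
  qed
  \<comment> \<open>Condition (4) at X = Y = I, both sides rewritten by the lifting
    equations.\<close>
  then have comm: "\<alpha> \<lhd> I = I \<rhd> \<alpha>" using I l_lift r_lift by metis
  show l_I: "l I = \<alpha>"
    by (rule fully_faithful_eqD[OF ffl II I l_Hom[OF I] \<alpha>_Hom]) (simp add: l_lift I comm)
  have r_I: "r I = \<alpha>"
    by (rule fully_faithful_eqD[OF ffr II I r_Hom[OF I] \<alpha>_Hom]) (simp add: r_lift I comm)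
  \<comment> \<open>Left tensoring with I turns both sides into \<alpha> whiskered by X and Y, and
    it is faithful.\<close>
  have l_tens: "l (X \<odot> Y) = l X \<lhd> Y" if X: "X \<in> Obj C" and Y: "Y \<in> Obj C" for X Y
  proof (rule fully_faithful_eqD[OF ffl])
    show "FArr (left_tens C I) (l (X \<odot> Y)) = FArr (left_tens C I) (l X \<lhd> Y)"
      by (simp add: l_lift[OF tens_obj_closed[OF X Y]] whisker_tens_obj(3)[OF I Y l_Hom[OF X], symmetric]
          l_lift[OF X] whisker_tens_obj(2)[OF X Y \<alpha>_Hom])
    show "l X \<lhd> Y \<in> Hom C (I \<odot> X \<odot> Y) (X \<odot> Y)"
      using right_whisker_closed[OF Y l_Hom[OF X]] by (simp add: tens_obj_assoc I X Y)
  qed (simp_all add: tens_obj_closed I X Y l_Hom)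
  have r_tens: "r (X \<odot> Y) = X \<rhd> r Y" if X: "X \<in> Obj C" and Y: "Y \<in> Obj C" for X Y
  proof (rule fully_faithful_eqD[OF ffr])
    show "FArr (right_tens C I) (r (X \<odot> Y)) = FArr (right_tens C I) (X \<rhd> r Y)"
      by (simp add: r_lift[OF tens_obj_closed[OF X Y]] whisker_tens_obj(3)[OF X I r_Hom[OF Y]]
          r_lift[OF Y] whisker_tens_obj(1)[OF X Y \<alpha>_Hom])
    show "X \<rhd> r Y \<in> Hom C ((X \<odot> Y) \<odot> I) (X \<odot> Y)"
      using left_whisker_closed[OF X r_Hom[OF Y]] by (simp add: tens_obj_assoc I X Y)
  qed (simp_all add: tens_obj_closed I X Y r_Hom)
  show "(l, r) \<in> LR_unit_structures C I"
    using nat_l nat_r l_I r_I l_tens r_tens middle by (simp add: LR_unit_structures_def)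
qed

text \<open>The restriction to objects makes each component \<open>undefined\<close> elsewhere, as
  membership in \<open>\<Pi>\<^sub>E\<close> demands.\<close>

definition lifted_unit :: "'o \<Rightarrow> 'a \<Rightarrow> ('o \<Rightarrow> 'a) \<times> ('o \<Rightarrow> 'a)" where
  "lifted_unit I \<alpha> =
     (\<lambda>X \<in> Obj C. THE f. f \<in> Hom C (I \<odot> X) X \<and> I \<rhd> f = \<alpha> \<lhd> X,
      \<lambda>X \<in> Obj C. THE f. f \<in> Hom C (X \<odot> I) X \<and> f \<lhd> I = X \<rhd> \<alpha>)"

lemma lifted_unit:
  assumes I: "I \<in> Obj C" and \<alpha>: "\<alpha> \<in> Saavedra_unit_structures C I"
  shows "lifted_unit I \<alpha> \<in> LR_unit_structures C I" and "fst (lifted_unit I \<alpha>) I = \<alpha>"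
proof -
  let ?l = "fst (lifted_unit I \<alpha>)" and ?r = "snd (lifted_unit I \<alpha>)"
  have l: "?l X \<in> Hom C (I \<odot> X) X \<and> I \<rhd> ?l X = \<alpha> \<lhd> X" if "X \<in> Obj C" for X
    using theI'[OF Saavedra_ex1(1)[OF I \<alpha> that]] by (simp add: lifted_unit_def that)
  have r: "?r X \<in> Hom C (X \<odot> I) X \<and> ?r X \<lhd> I = X \<rhd> \<alpha>" if "X \<in> Obj C" for X
    using theI'[OF Saavedra_ex1(2)[OF I \<alpha> that]] by (simp add: lifted_unit_def that)
  have "?l \<in> extensional (Obj C)" "?r \<in> extensional (Obj C)" by (simp_all add: lifted_unit_def)
  then have "?l \<in> (\<Pi>\<^sub>E X \<in> Obj C. Hom C (I \<odot> X) X)" "?r \<in> (\<Pi>\<^sub>E X \<in> Obj C. Hom C (X \<odot> I) X)"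
    using l r by (simp_all add: PiE_def Pi_def)
  from LR_unit_if_lifts[OF I \<alpha> this] l r
  show "lifted_unit I \<alpha> \<in> LR_unit_structures C I" "?l I = \<alpha>" by simp_all
qed

text \<open>By \<open>LR_unit_lifts\<close> the given components solve the lifting problems for
  \<open>l I\<close>, so uniqueness identifies them with the chosen ones; off the objects both sides
  are \<open>undefined\<close>.\<close>

lemma lifted_unit_LR_unit:
  assumes I: "I \<in> Obj C" and LR: "(l, r) \<in> LR_unit_structures C I"
  shows "lifted_unit I (l I) = (l, r)"
proof -
  note lr = LR_unit_lifts[OF I LR]
  have "fst (lifted_unit I (l I)) = l"
  proof (rule extensionalityI[of _ "Obj C"])
    fix X assume X: "X \<in> Obj C"
    then show "fst (lifted_unit I (l I)) X = l X"
      using the1_equality[OF Saavedra_ex1(1)[OF I lr(1) X], of "l X"] PiE_mem[OF lr(2) X] lr(4)[OF X]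
      by (simp add: lifted_unit_def)
  qed (use lr(2) in \<open>simp_all add: lifted_unit_def PiE_def\<close>)
  moreover have "snd (lifted_unit I (l I)) = r"
  proof (rule extensionalityI[of _ "Obj C"])
    fix X assume X: "X \<in> Obj C"
    then show "snd (lifted_unit I (l I)) X = r X"
      using the1_equality[OF Saavedra_ex1(2)[OF I lr(1) X], of "r X"] PiE_mem[OF lr(3) X] lr(5)[OF X]
      by (simp add: lifted_unit_def)
  qed (use lr(3) in \<open>simp_all add: lifted_unit_def PiE_def\<close>)
  ultimately show ?thesis by (simp add: prod_eq_iff)
qed

end

theorem proposition2p9:
  fixes C :: "('o, 'a) semi_monoidal" and I :: 'o
  assumes "semi_monoidal_category C" and "I \<in> Obj C"
  shows
    "bij_betw (\<lambda>(l, r). l I) (LR_unit_structures C I) (Saavedra_unit_structures C I) \<and>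
     (\<forall>(l, r) \<in> LR_unit_structures C I. l I = r I) \<and>
     (\<forall>\<alpha> \<in> Saavedra_unit_structures C I.
        (\<forall>X \<in> Obj C. \<exists>!f. f \<in> Hom C (I \<odot>\<^bsub>C\<^esub> X) X \<and> I \<rhd>\<^bsub>C\<^esub> f = \<alpha> \<lhd>\<^bsub>C\<^esub> X) \<and>
        (\<forall>X \<in> Obj C. \<exists>!f. f \<in> Hom C (X \<odot>\<^bsub>C\<^esub> I) X \<and> f \<lhd>\<^bsub>C\<^esub> I = X \<rhd>\<^bsub>C\<^esub> \<alpha>) \<and>
        inv_into (LR_unit_structures C I) (\<lambda>(l, r). l I) \<alpha> =
          (\<lambda>X \<in> Obj C. THE f. f \<in> Hom C (I \<odot>\<^bsub>C\<^esub> X) X \<and> I \<rhd>\<^bsub>C\<^esub> f = \<alpha> \<lhd>\<^bsub>C\<^esub> X,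
           \<lambda>X \<in> Obj C. THE f. f \<in> Hom C (X \<odot>\<^bsub>C\<^esub> I) X \<and> f \<lhd>\<^bsub>C\<^esub> I = X \<rhd>\<^bsub>C\<^esub> \<alpha>))"
proof -
  interpret semi_monoidal_category C by fact
  note I = \<open>I \<in> Obj C\<close>
  let ?\<Phi> = "\<lambda>(l, r). l I" and ?LR = "LR_unit_structures C I" and ?S = "Saavedra_unit_structures C I"
  have bij: "bij_betw ?\<Phi> ?LR ?S"
    \<comment> \<open>The round trip from \<alpha> is the second part of \<open>lifted_unit\<close>,
      the one from \<open>(l, r)\<close> is \<open>lifted_unit_LR_unit\<close>.\<close>
    by (rule bij_betw_byWitness[where f' = "lifted_unit I"])
      (use lifted_unit[OF I] lifted_unit_LR_unit[OF I] LR_unit_lifts(1)[OF I]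
        in \<open>auto simp add: case_prod_unfold image_subset_iff\<close>)
  \<comment> \<open>\<open>inv_into\<close> picks some preimage of \<alpha>; injectivity leaves
    \<open>lifted_unit I \<alpha>\<close> as the only candidate.\<close>
  moreover have "inv_into ?LR ?\<Phi> \<alpha> = lifted_unit I \<alpha>" if "\<alpha> \<in> ?S" for \<alpha>
    using inv_into_f_eq[OF bij_betw_imp_inj_on[OF bij] lifted_unit(1)[OF I that]]
      lifted_unit(2)[OF I that] by (simp add: case_prod_unfold)
  moreover have "\<forall>(l, r) \<in> ?LR. l I = r I" by (auto simp: LR_unit_structures_def)
  ultimately show ?thesis
    using Saavedra_ex1[OF I] unfolding lifted_unit_def by (intro conjI ballI) simp_all
qed

end
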